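(* The sequence $\{\mathcal A^{(k)}\}_{k\ge 0}$ is a filtration of the non-symmetric associative operad $\mathcal A$, i.e. $$\mathcal A^{(k)}_n\circ_i\mathcal A^{(h)}_m\subseteq\mathcal A^{(k+h)}_{n+m-1}\quad\text{for any } n,m\ge 1,\ k,h\ge 0,\text{ and } i=1,\dots,n.$$ In particular, the space of primitive elements $\mathcal A^{(0)}=\{\mathcal A^{(0)}_n\}_{n\ge1}$ is a non-symmetric suboperad of $\mathcal A$.
   Context: $\Bbbk$ is a commutative ring; "space" means $\Bbbk$-module. $[n]=\{1,\dots,n\}$; a permutation $\sigma\in S_n$ is written as the list $(\sigma_1,\dots,\sigma_n)$ of its values. For a sequence $a$ of $n$ distinct integers, $\mathrm{st}(a)\in S_n$ is the unique permutation with $\mathrm{st}(a)_p<\mathrm{st}(a)_q\iff a_p<a_q$. Operad. $\mathcal A_n:=\Bbbk S_n$ has basis $\{F_\sigma\}_{\sigma\in S_n}$, $n\ge1$. For $\sigma\in S_n,\tau\in S_m,i\in[n]$, $B_i(\sigma,\tau):=(a_1,\dots,a_{i-1},b_1,\dots,b_m,a_{i+1},\dots,a_n)\in S_{n+m-1}$, where $a_j=\sigma_j$ if $\sigma_j<\sigma_i$, $a_j=\sigma_j+m-1$ if $\sigma_j>\sigma_i$, and $b_k=\tau_k+\sigma_i-1$. The linear maps $\circ_i:\mathcal A_n\otimes\mathcal A_m\to\mathcal A_{n+m-1}$, $F_\sigma\circ_iF_\tau=F_{B_i(\sigma,\tau)}$, make $\mathcal A=\{\mathcal A_n\}_{n\ge1}$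 a non-symmetric unital operad with unit $F_{(1)}\in\mathcal A_1$. A non-symmetric suboperad is a sequence of subspaces closed under all $\circ_i$ and containing the unit. Coalgebra. $H:=\bigoplus_{n\ge1}\Bbbk S_n$ with the (non-counital) coproduct given for $\sigma\in S_n$ by $$\Delta(F_\sigma)=\sum_{i=1}^{n-1}F_{\mathrm{st}(\sigma_1,\dots,\sigma_i)}\otimes F_{\mathrm{st}(\sigma_{i+1},\dots,\sigma_n)}.$$ Let $\Delta^{(1)}:=\Delta$, $\Delta^{(k+1)}:=(\Delta\otimes\mathrm{id}^{\otimes k})\circ\Delta^{(k)}$. For $k\ge1$, $H^{(k)}:=\ker(\Delta^{(k)}:H\to H^{\otimes(k+1)})$ and $H^{(k)}_n:=H^{(k)}\cap\Bbbk S_n$; $H^{(1)}$ is the space of primitive elements, and $H^{(1)}\subseteq H^{(2)}\subseteq\cdots$. For $k\ge0$, $\mathcal A^{(k)}$ is the sequence of spaces $\mathcal A^{(k)}_n:=H^{(k+1)}_n$, $n\ge1$. *)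

theory Defs
  imports "HOL-Library.Poly_Mapping" "HOL-Combinatorics.Multiset_Permutations"
begin

section \<open>Free modules and linear extension\<close>

text \<open>
  The free \<open>'k\<close>-module on a set of basis elements of type \<open>'a\<close> consists of the finitely
  supported functions \<open>'a \<Rightarrow>\<^sub>0 'k\<close>.
\<close>

definition scale :: "'k::comm_ring_1 \<Rightarrow> ('a \<Rightarrow>\<^sub>0 'k) \<Rightarrow> ('a \<Rightarrow>\<^sub>0 'k)" where
  "scale c x = Poly_Mapping.map (\<lambda>v. c * v) x"

definition basis :: "'a \<Rightarrow> ('a \<Rightarrow>\<^sub>0 'k::comm_ring_1)" where
  "basis a = Poly_Mapping.single a 1"

definition lin_ext :: "('a \<Rightarrow> ('b \<Rightarrow>\<^sub>0 'k)) \<Rightarrow> ('a \<Rightarrow>\<^sub>0 'k::comm_ring_1) \<Rightarrow> ('b \<Rightarrow>\<^sub>0 'k)" where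
  "lin_ext f x = (\<Sum>a\<in>Poly_Mapping.keys x. scale (Poly_Mapping.lookup x a) (f a))"

lemma lookup_scale [simp]:
  "Poly_Mapping.lookup (scale c x) a = c * Poly_Mapping.lookup x a"
  by (simp add: scale_def Poly_Mapping.map.rep_eq when_def)

interpretation free_module: module "scale :: 'k::comm_ring_1 \<Rightarrow> ('a \<Rightarrow>\<^sub>0 'k) \<Rightarrow> ('a \<Rightarrow>\<^sub>0 'k)"
  by unfold_locales
    (auto intro!: poly_mapping_eqI simp: lookup_add algebra_simps)

lemma lin_ext_superset:
  assumes "finite A" "Poly_Mapping.keys x \<subseteq> A"
  shows "lin_ext f x = (\<Sum>a\<in>A. scale (Poly_Mapping.lookup x a) (f a))"
  unfolding lin_ext_def
  by (rule sum.mono_neutral_left) (use assms in \<open>auto simp: in_keys_iff\<close>)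

lemma lin_ext_basis [simp]: "lin_ext f (basis a) = f a"
  by (cases "(1::'b::comm_ring_1) = 0") (simp_all add: lin_ext_def basis_def)

lemma lin_ext_add: "lin_ext f (x + y) = lin_ext f x + lin_ext f y"
proof -
  let ?A = "Poly_Mapping.keys x \<union> Poly_Mapping.keys y"
  have "Poly_Mapping.keys (x + y) \<subseteq> ?A"
    by (rule Poly_Mapping.keys_add)
  then have "lin_ext f (x + y) = (\<Sum>a\<in>?A. scale (Poly_Mapping.lookup (x + y) a) (f a))"
    by (intro lin_ext_superset) auto
  also have "\<dots> = (\<Sum>a\<in>?A. scale (Poly_Mapping.lookup x a) (f a))
      + (\<Sum>a\<in>?A. scale (Poly_Mapping.lookup y a) (f a))"
    by (simp add: lookup_add free_module.scale_left_distrib sum.distrib)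
  also have "\<dots> = lin_ext f x + lin_ext f y"
    by (subst (1 2) lin_ext_superset [of ?A]) auto
  finally show ?thesis .
qed

lemma lin_ext_scale: "lin_ext f (scale c x) = scale c (lin_ext f x)"
proof -
  have "lin_ext f (scale c x)
      = (\<Sum>a\<in>Poly_Mapping.keys x. scale (Poly_Mapping.lookup (scale c x) a) (f a))"
    by (rule lin_ext_superset) (auto simp: in_keys_iff)
  then show ?thesis
    by (simp add: lin_ext_def free_module.scale_sum_right)
qed

lemma module_hom_lin_ext: "module_hom scale scale (lin_ext f)"
  by unfold_locales (simp_all add: lin_ext_add lin_ext_scale)

lemma basis_expansion:
  "x = (\<Sum>a\<in>Poly_Mapping.keys x. scale (Poly_Mapping.lookup x a) (basis a))"
  by (rule poly_mapping_eqI)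
    (auto simp: lookup_sum basis_def lookup_single when_def in_keys_iff if_distrib cong: if_cong)


section \<open>Tensor powers\<close>

text \<open>
  If \<open>H\<close> is free with basis \<open>S\<close>, then its \<open>r\<close>-th tensor power is free on the words of length \<open>r\<close>
  over \<open>S\<close>: the word \<open>[s\<^sub>1, \<dots>, s\<^sub>r]\<close> stands for \<open>s\<^sub>1 \<otimes> \<dots> \<otimes> s\<^sub>r\<close>. All tensor powers thus live in the
  one type \<open>'s list \<Rightarrow>\<^sub>0 'k\<close>, and the tensor product of tensors is bilinear extension of
  concatenation.
\<close>

definition tensor ::
    "('s list \<Rightarrow>\<^sub>0 'k::comm_ring_1) \<Rightarrow> ('s list \<Rightarrow>\<^sub>0 'k) \<Rightarrow> ('s list \<Rightarrow>\<^sub>0 'k)" where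
  "tensor x y = lin_ext (\<lambda>u. lin_ext (\<lambda>v. basis (u @ v)) y) x"

text \<open>
  \<open>tensor_map f g\<close> is \<open>f \<otimes> g\<close>, where \<open>f\<close> acts on the first tensor factor and \<open>g\<close> on the
  remaining ones. It is only applied to tensors of positive degree.
\<close>

definition tensor_map ::
    "(('s \<Rightarrow>\<^sub>0 'k) \<Rightarrow> ('s list \<Rightarrow>\<^sub>0 'k)) \<Rightarrow> (('s list \<Rightarrow>\<^sub>0 'k) \<Rightarrow> ('s list \<Rightarrow>\<^sub>0 'k))
      \<Rightarrow> ('s list \<Rightarrow>\<^sub>0 'k::comm_ring_1) \<Rightarrow> ('s list \<Rightarrow>\<^sub>0 'k)" where
  "tensor_map f g =
     lin_ext (\<lambda>w. case w of [] \<Rightarrow> 0 | s # v \<Rightarrow> tensor (f (basis s)) (g (basis v)))"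


section \<open>Permutations in one-line notation\<close>

definition perms :: "nat \<Rightarrow> nat list set" where
  "perms n = permutations_of_set {1..n}"

definition st :: "nat list \<Rightarrow> nat list" where
  "st a = (THE t. t \<in> perms (length a) \<and>
     (\<forall>p<length a. \<forall>q<length a. t ! p < t ! q \<longleftrightarrow> a ! p < a ! q))"

text \<open>
  For \<open>\<sigma> \<in> S\<^sub>n\<close>, \<open>\<tau> \<in> S\<^sub>m\<close> and \<open>1 \<le> i \<le> n\<close>; list indices start at 0, so \<open>\<sigma>\<^sub>i\<close> is \<open>\<sigma> ! (i - 1)\<close>.
  The truncated subtractions are exact because \<open>m \<ge> 1\<close> and all entries are positive.
\<close>

definition B :: "nat \<Rightarrow> nat list \<Rightarrow> nat list \<Rightarrow> nat list" where
  "B i \<sigma> \<tau> =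
     (let s = \<sigma> ! (i - 1);
          m = length \<tau>;
          a = (\<lambda>v. if v < s then v else v + m - 1);
          b = (\<lambda>v. v + s - 1)
      in map a (take (i - 1) \<sigma>) @ map b \<tau> @ map a (drop i \<sigma>))"


section \<open>The operad\<close>

text \<open>
  \<open>\<A> n\<close> is the submodule spanned by the \<open>basis \<sigma>\<close> with \<open>\<sigma> \<in> S\<^sub>n\<close>; only \<open>n \<ge> 1\<close> is meaningful.
\<close>

definition \<A> :: "nat \<Rightarrow> (nat list \<Rightarrow>\<^sub>0 'k::comm_ring_1) set" where
  "\<A> n = {x. Poly_Mapping.keys x \<subseteq> perms n}"

definition circ ::
    "nat \<Rightarrow> (nat list \<Rightarrow>\<^sub>0 'k::comm_ring_1) \<Rightarrow> (nat list \<Rightarrow>\<^sub>0 'k) \<Rightarrow> (nat list \<Rightarrow>\<^sub>0 'k)" where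
  "circ i x y = lin_ext (\<lambda>\<sigma>. lin_ext (\<lambda>\<tau>. basis (B i \<sigma> \<tau>)) y) x"

definition operad_unit :: "nat list \<Rightarrow>\<^sub>0 'k::comm_ring_1" where
  "operad_unit = basis [1]"

definition subspace_sequence :: "(nat \<Rightarrow> (nat list \<Rightarrow>\<^sub>0 'k::comm_ring_1) set) \<Rightarrow> bool" where
  "subspace_sequence P \<longleftrightarrow> (\<forall>n\<ge>1. free_module.subspace (P n) \<and> P n \<subseteq> \<A> n)"

definition ns_suboperad :: "(nat \<Rightarrow> (nat list \<Rightarrow>\<^sub>0 'k::comm_ring_1) set) \<Rightarrow> bool" where
  "ns_suboperad P \<longleftrightarrow>
     subspace_sequence P \<and>
     operad_unit \<in> P 1 \<and>
     (\<forall>n\<ge>1. \<forall>m\<ge>1. \<forall>i\<in>{1..n}. \<forall>x\<in>P n. \<forall>y\<in>P m. circ i x y \<in> P (n + m - 1))"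

definition ns_operad_filtration ::
    "(nat \<Rightarrow> nat \<Rightarrow> (nat list \<Rightarrow>\<^sub>0 'k::comm_ring_1) set) \<Rightarrow> bool" where
  "ns_operad_filtration P \<longleftrightarrow>
     (\<forall>k. subspace_sequence (P k)) \<and>
     (\<forall>k. \<forall>n\<ge>1. P k n \<subseteq> P (Suc k) n) \<and>
     (\<forall>n\<ge>1. \<forall>m\<ge>1. \<forall>k h. \<forall>i\<in>{1..n}. \<forall>x\<in>P k n. \<forall>y\<in>P h m.
        circ i x y \<in> P (k + h) (n + m - 1))"


section \<open>The coalgebra\<close>

definition H :: "(nat list \<Rightarrow>\<^sub>0 'k::comm_ring_1) set" where
  "H = {x. Poly_Mapping.keys x \<subseteq> (\<Union>n\<in>{1..}. perms n)}"

definition Delta :: "(nat list \<Rightarrow>\<^sub>0 'k::comm_ring_1) \<Rightarrow> (nat list list \<Rightarrow>\<^sub>0 'k)" where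
  "Delta = lin_ext (\<lambda>\<sigma>. \<Sum>i = 1..length \<sigma> - 1. basis [st (take i \<sigma>), st (drop i \<sigma>)])"

text \<open>The iterates are indexed from 1; the value at 0 is unspecified and never used.\<close>

fun Delta_iter :: "nat \<Rightarrow> (nat list \<Rightarrow>\<^sub>0 'k::comm_ring_1) \<Rightarrow> (nat list list \<Rightarrow>\<^sub>0 'k)" where
  "Delta_iter (Suc 0) = Delta"
| "Delta_iter (Suc (Suc k)) = tensor_map Delta id \<circ> Delta_iter (Suc k)"

definition Hker :: "nat \<Rightarrow> (nat list \<Rightarrow>\<^sub>0 'k::comm_ring_1) set" where
  "Hker k = {x \<in> H. Delta_iter k x = 0}"

definition Afilt :: "nat \<Rightarrow> nat \<Rightarrow> (nat list \<Rightarrow>\<^sub>0 'k::comm_ring_1) set" where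
  "Afilt k n = Hker (k + 1) \<inter> \<A> n"


section \<open>Sanity checks\<close>

lemma lin_ext_hom:
  assumes "module_hom scale scale f"
  shows "f x = lin_ext (\<lambda>a. f (basis a)) x"
proof -
  interpret f: module_hom scale scale f by fact
  have "f x = f (\<Sum>a\<in>Poly_Mapping.keys x. scale (Poly_Mapping.lookup x a) (basis a))"
    by (subst basis_expansion [of x]) (rule refl)
  then show ?thesis
    by (simp add: f.sum f.scale lin_ext_def)
qed

lemma lin_ext_sum_fun: "lin_ext (\<lambda>a. f a + g a) x = lin_ext f x + lin_ext g x"
  by (simp add: lin_ext_def free_module.scale_right_distrib sum.distrib)

lemma lin_ext_scale_fun: "lin_ext (\<lambda>a. scale c (f a)) x = scale c (lin_ext f x)"
  by (simp add: lin_ext_def free_module.scale_sum_right mult.commute)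

lemma module_hom_eqI:
  assumes "module_hom scale scale f" "module_hom scale scale g" "\<And>a. f (basis a) = g (basis a)"
  shows "f x = g x"
  by (subst lin_ext_hom [OF assms(1)], subst lin_ext_hom [OF assms(2)]) (simp only: assms(3))

lemma module_hom_tensor_left: "module_hom scale scale (\<lambda>x. tensor x y)"
  unfolding tensor_def by (rule module_hom_lin_ext)

lemma module_hom_tensor_right: "module_hom scale scale (tensor x)"
  unfolding tensor_def
  by unfold_locales
    (simp_all add: lin_ext_add lin_ext_scale lin_ext_sum_fun lin_ext_scale_fun)

lemmas tensor_add_left = module_hom.add [OF module_hom_tensor_left]
  and tensor_scale_left = module_hom.scale [OF module_hom_tensor_left]
  and tensor_add_right = module_hom.add [OF module_hom_tensor_right]
  and tensor_scale_right = module_hom.scale [OF module_hom_tensor_right]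

lemma tensor_basis [simp]: "tensor (basis u) (basis v) = basis (u @ v)"
  by (simp add: tensor_def)

text \<open>The defining property of \<open>f \<otimes> g\<close>; \<open>lin_ext (\<lambda>s. basis [s])\<close> identifies \<open>H\<close> with its first
  tensor power.\<close>

lemma tensor_map_tensor:
  assumes f: "module_hom scale scale f" and g: "module_hom scale scale g"
  shows "tensor_map f g (tensor (lin_ext (\<lambda>s. basis [s]) x) y) = tensor (f x) (g y)"
proof -
  interpret f: module_hom scale scale f by fact
  interpret g: module_hom scale scale g by fact
  have map_hom: "module_hom scale scale (tensor_map f g)"
    unfolding tensor_map_def by (rule module_hom_lin_ext)
  interpret m: module_hom scale scale "tensor_map f g" by (fact map_hom)
  have 1: "tensor_map f g (tensor (basis [s]) y) = tensor (f (basis s)) (g y)" for s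
  proof (rule module_hom_eqI [where f = "\<lambda>y. tensor_map f g (tensor (basis [s]) y)"
        and g = "\<lambda>y. tensor (f (basis s)) (g y)"])
    show "module_hom scale scale (\<lambda>y. tensor_map f g (tensor (basis [s]) y))"
      by unfold_locales (simp_all add: tensor_add_right tensor_scale_right m.add m.scale)
    show "module_hom scale scale (\<lambda>y. tensor (f (basis s)) (g y))"
      by unfold_locales (simp_all add: tensor_add_right tensor_scale_right g.add g.scale)
  qed (simp add: tensor_map_def)
  show ?thesis
  proof (rule module_hom_eqI
      [where f = "\<lambda>x. tensor_map f g (tensor (lin_ext (\<lambda>s. basis [s]) x) y)"
        and g = "\<lambda>x. tensor (f x) (g y)"])
    show "module_hom scale scale (\<lambda>x. tensor_map f g (tensor (lin_ext (\<lambda>s. basis [s]) x) y))"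
      by unfold_locales
        (simp_all add: lin_ext_add lin_ext_scale tensor_add_left tensor_scale_left m.add m.scale)
    show "module_hom scale scale (\<lambda>x. tensor (f x) (g y))"
      by unfold_locales (simp_all add: tensor_add_left tensor_scale_left f.add f.scale)
  qed (simp add: 1)
qed

lemma perms_iff: "t \<in> perms n \<longleftrightarrow> length t = n \<and> distinct t \<and> set t = {1..n}"
  using distinct_card [of t] by (auto simp: perms_def permutations_of_set_def)

lemma perms_card: "length t = n \<Longrightarrow> set t = {1..n} \<Longrightarrow> t \<in> perms n"
  by (simp add: perms_iff card_distinct)

text \<open>\<open>st\<close> is well defined: \<open>st a\<close> lists the ranks of the entries of \<open>a\<close>.\<close>

lemma st_unique:
  assumes a: "distinct a"
  shows "\<exists>!t. t \<in> perms (length a) \<and>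
     (\<forall>p<length a. \<forall>q<length a. t ! p < t ! q \<longleftrightarrow> a ! p < a ! q)" (is "\<exists>!t. ?P t")
    and "st a = map (\<lambda>v. card {w \<in> set a. w \<le> v}) a"
proof -
  define n where "n = length a"
  define r where "r = (\<lambda>v. card {w \<in> set a. w \<le> v})"
  have mono: "r v < r v'" if "v < v'" "v' \<in> set a" for v v'
  proof -
    have "v' \<in> {w \<in> set a. w \<le> v'} - {w \<in> set a. w \<le> v}" using that by simp
    then have "{w \<in> set a. w \<le> v} \<subset> {w \<in> set a. w \<le> v'}"
    proof (intro psubsetI subsetI)
      fix x assume "x \<in> {w \<in> set a. w \<le> v}"
      then show "x \<in> {w \<in> set a. w \<le> v'}" using that(1) by simp
    qed blast
    then show ?thesis unfolding r_def by (intro psubset_card_mono) auto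
  qed
  have iff: "r v < r v' \<longleftrightarrow> v < v'" if "v \<in> set a" "v' \<in> set a" for v v'
    using mono [of v v'] mono [of v' v] that by (metis less_asym linorder_neqE_nat less_irrefl)
  have "r v \<in> {1..n}" if "v \<in> set a" for v
  proof -
    have "r v \<le> card (set a)" unfolding r_def by (rule card_mono) auto
    moreover have "0 < r v" unfolding r_def using that by (auto simp: card_gt_0_iff)
    ultimately show ?thesis using distinct_card [OF a] by (simp add: n_def)
  qed
  then have sub: "set (map r a) \<subseteq> {1..n}" by auto
  have "inj_on r (set a)"
    by (rule inj_onI) (metis iff less_irrefl linorder_neqE_nat)
  then have "card (set (map r a)) = n"
    using distinct_card [OF a] by (simp add: card_image n_def)
  then have "set (map r a) = {1..n}"
    using sub by (intro card_subset_eq) auto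
  then have "map r a \<in> perms n"
    by (intro perms_card) (simp_all add: n_def)
  then have ex: "?P (map r a)"
    by (simp add: n_def iff)
  have uniq: "t = map r a" if t: "?P t" for t
  proof (rule nth_equalityI)
    have len: "length t = n" "distinct t" "set t = {1..n}"
      using t by (auto simp: perms_iff n_def)
    then show "length t = length (map r a)" by (simp add: n_def)
    fix p assume "p < length t"
    then have p: "p < n" using len by simp
    have le: "t ! q \<le> t ! p \<longleftrightarrow> a ! q \<le> a ! p" if "q < n" for q
      using t p that by (auto simp: n_def simp flip: not_less)
    have "t ! p \<in> set t" using p len nth_mem by metis
    then have "{w \<in> set t. w \<le> t ! p} = {1..t ! p}" using len(3) by auto
    then have "t ! p = card {w \<in> set t. w \<le> t ! p}" by simp
    also have "{w \<in> set t. w \<le> t ! p} = (!) t ` {q. q < n \<and> t ! q \<le> t ! p}"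
      using len(1) by (auto simp: set_conv_nth)
    also have "card \<dots> = card {q. q < n \<and> t ! q \<le> t ! p}"
      by (rule card_image) (use len in \<open>auto simp: inj_on_def nth_eq_iff_index_eq\<close>)
    also have "{q. q < n \<and> t ! q \<le> t ! p} = {q. q < n \<and> a ! q \<le> a ! p}"
      using le by auto
    also have "card \<dots> = card ((!) a ` {q. q < n \<and> a ! q \<le> a ! p})"
      by (rule card_image [symmetric])
        (use a in \<open>auto simp: inj_on_def nth_eq_iff_index_eq n_def\<close>)
    also have "(!) a ` {q. q < n \<and> a ! q \<le> a ! p} = {w \<in> set a. w \<le> a ! p}"
      by (auto simp: set_conv_nth n_def)
    finally show "t ! p = map r a ! p"
      using p by (simp add: n_def r_def)
  qed
  show "\<exists>!t. ?P t" by (rule ex1I) (fact ex, fact uniq)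
  show "st a = map (\<lambda>v. card {w \<in> set a. w \<le> v}) a"
    unfolding st_def r_def [symmetric] by (rule the_equality) (fact ex, fact uniq)
qed

lemma B_in_perms:
  assumes \<sigma>: "\<sigma> \<in> perms n" and \<tau>: "\<tau> \<in> perms m" and i: "i \<in> {1..n}" and m: "m \<ge> 1"
  shows "B i \<sigma> \<tau> \<in> perms (n + m - 1)"
proof (rule perms_card)
  define s where "s = \<sigma> ! (i - 1)"
  define a where "a = (\<lambda>v. if v < s then v else v + m - 1)"
  have len: "length \<sigma> = n" "length \<tau> = m" "set \<sigma> = {1..n}" "set \<tau> = {1..m}" "distinct \<sigma>"
    using \<sigma> \<tau> by (auto simp: perms_iff)
  have B: "B i \<sigma> \<tau> = map a (take (i - 1) \<sigma>) @ map (\<lambda>v. v + s - 1) \<tau> @ map a (drop i \<sigma>)"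
    by (simp add: B_def Let_def s_def a_def len)
  show "length (B i \<sigma> \<tau>) = n + m - 1"
    using i m by (simp add: B len min_absorb2, arith?)
  have split: "\<sigma> = take (i - 1) \<sigma> @ s # drop i \<sigma>"
  proof -
    have "i - 1 < length \<sigma>" "Suc (i - 1) = i" using i len by auto
    then show ?thesis unfolding s_def by (metis id_take_nth_drop)
  qed
  have rest: "set (take (i - 1) \<sigma>) \<union> set (drop i \<sigma>) = {1..n} - {s}"
  proof -
    have "distinct (take (i - 1) \<sigma> @ s # drop i \<sigma>)" "set (take (i - 1) \<sigma> @ s # drop i \<sigma>) = {1..n}"
      using len unfolding split [symmetric] by simp_all
    then show ?thesis by auto
  qed
  have s: "s \<in> {1..n}"
    using split len(3) by (metis in_set_conv_decomp)
  have a_image: "a ` ({1..n} - {s}) = {1..<s} \<union> {s + m..n + m - 1}" (is "?L = ?R")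
  proof
    show "?L \<subseteq> ?R" using s m by (auto simp: a_def)
    show "?R \<subseteq> ?L"
    proof
      fix v assume v: "v \<in> ?R"
      show "v \<in> ?L"
      proof (cases "v < s")
        case True
        then have "v = a v" "v \<in> {1..n} - {s}" using v s by (auto simp: a_def)
        then show ?thesis by blast
      next
        case False
        then have "v = a (v + 1 - m)" "v + 1 - m \<in> {1..n} - {s}"
          using v s m by (auto simp: a_def)
        then show ?thesis by blast
      qed
    qed
  qed
  have b_image: "(\<lambda>v. v + s - 1) ` {1..m} = {s..<s + m}" (is "?L = ?R")
  proof
    show "?L \<subseteq> ?R" using s by auto
    show "?R \<subseteq> ?L"
    proof
      fix v assume "v \<in> ?R"
      then have "v = (v + 1 - s) + s - 1" "v + 1 - s \<in> {1..m}" using s by auto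
      then show "v \<in> ?L" by blast
    qed
  qed
  have "set (B i \<sigma> \<tau>)
      = a ` (set (take (i - 1) \<sigma>) \<union> set (drop i \<sigma>)) \<union> (\<lambda>v. v + s - 1) ` set \<tau>"
    unfolding B set_append set_map image_Un by blast
  also have "\<dots> = {1..<s} \<union> {s + m..n + m - 1} \<union> {s..<s + m}"
    by (simp only: rest len(4) a_image b_image)
  also have "\<dots> = {1..n + m - 1}"
  proof (rule set_eqI)
    fix v
    have "1 \<le> s" "s \<le> n" using s by simp_all
    then show "v \<in> {1..<s} \<union> {s + m..n + m - 1} \<union> {s..<s + m} \<longleftrightarrow> v \<in> {1..n + m - 1}"
      unfolding Un_iff atLeastAtMost_iff atLeastLessThan_iff using m by linarith
  qed
  finally show "set (B i \<sigma> \<tau>) = {1..n + m - 1}" .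
qed

end

theory Submission
  imports Defs
begin

text \<open>
  Standardising a block before cutting it does not change the standardised pieces, and cutting the
  first block again and again reaches every way of cutting a list exactly once, from the last cut
  to the first. So the \<open>r\<close>-fold coproduct sends \<open>F\<^sub>\<sigma>\<close> to the sum, over all ways of cutting the
  list \<open>\<sigma>\<close> at \<open>r\<close> of its gaps, of the tensor product of the standardised blocks
  (\<open>Delta_iter_basis\<close>). The lengths of the blocks can be read off from the tensor, so different sets
  of cuts contribute to different graded components: \<open>x \<in> \<A>\<^sub>n\<close> is killed by the \<open>r\<close>-fold
  coproduct iff, for every single set \<open>C\<close> of \<open>r\<close> gaps, the linear map sending \<open>F\<^sub>\<sigma>\<close> to its
  standardised blocks along \<open>C\<close> kills \<open>x\<close> (\<open>Delta_iter_eq_0_iff\<close>).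

  The list \<open>B\<^sub>i(\<sigma>,\<tau>)\<close> has \<open>n + m - 2\<close> gaps, of which \<open>m - 1\<close> lie inside the inserted copy of \<open>\<tau>\<close>
  and the other \<open>n - 1\<close> are the gaps of \<open>\<sigma>\<close>. Let \<open>k + h + 1\<close> cuts of \<open>B\<^sub>i(\<sigma>,\<tau>)\<close> be given; they split
  into outer cuts of \<open>\<sigma>\<close> and inner cuts of \<open>\<tau>\<close>. The values of the inserted copy form an interval
  which sits relative to the other values exactly as \<open>\<sigma>\<^sub>i\<close> does. Hence the relative order inside
  the blocks of \<open>B\<^sub>i(\<sigma>,\<tau>)\<close> depends only on the relative order inside the blocks of \<open>\<sigma>\<close> along the
  outer cuts and of \<open>\<tau>\<close> along the inner cuts (\<open>agree_B\<close>). In other words, the component of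
  the coproduct of \<open>x \<circ>\<^sub>i y\<close> is a bilinear function of the two corresponding components for \<open>x\<close> and
  \<open>y\<close>. By the pigeonhole principle there are at least \<open>k + 1\<close> outer cuts or at least \<open>h + 1\<close> inner
  cuts, so one of the two arguments of this bilinear function vanishes (\<open>circ_in_Afilt\<close>).
\<close>

section \<open>Linear extension\<close>

lemma lin_ext_cong:
  assumes "\<And>a. a \<in> Poly_Mapping.keys x \<Longrightarrow> f a = g a"
  shows "lin_ext f x = lin_ext g x"
  unfolding lin_ext_def using assms by (intro sum.cong) auto

lemma lin_ext_zero [simp]: "lin_ext f 0 = 0"
  by (simp add: lin_ext_def)

lemma lin_ext_sum: "lin_ext f (\<Sum>i\<in>I. g i) = (\<Sum>i\<in>I. lin_ext f (g i))"
  by (rule module_hom.sum [OF module_hom_lin_ext])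

lemma lin_ext_lin_ext: "lin_ext h (lin_ext f x) = lin_ext (\<lambda>a. lin_ext h (f a)) x"
  by (simp add: lin_ext_def [of f] lin_ext_def [of "\<lambda>a. lin_ext h (f a)"] lin_ext_sum lin_ext_scale)

lemma lin_ext_sum_functions: "lin_ext (\<lambda>a. \<Sum>i\<in>I. f i a) x = (\<Sum>i\<in>I. lin_ext (f i) x)"
proof -
  have "lin_ext (\<lambda>a. \<Sum>i\<in>I. f i a) x =
      (\<Sum>a\<in>Poly_Mapping.keys x. \<Sum>i\<in>I. scale (Poly_Mapping.lookup x a) (f i a))"
    by (simp add: lin_ext_def free_module.scale_sum_right)
  also have "\<dots> = (\<Sum>i\<in>I. lin_ext (f i) x)"
    unfolding lin_ext_def by (rule sum.swap)
  finally show ?thesis .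
qed

lemma lookup_lin_ext:
  "Poly_Mapping.lookup (lin_ext f x) w =
    (\<Sum>a\<in>Poly_Mapping.keys x. Poly_Mapping.lookup x a * Poly_Mapping.lookup (f a) w)"
  by (simp add: lin_ext_def lookup_sum)

lemma keys_lin_ext_subset:
  assumes "\<And>a. a \<in> Poly_Mapping.keys x \<Longrightarrow> Poly_Mapping.keys (f a) \<subseteq> S"
  shows "Poly_Mapping.keys (lin_ext f x) \<subseteq> S"
proof
  fix w assume "w \<in> Poly_Mapping.keys (lin_ext f x)"
  then have "Poly_Mapping.lookup (lin_ext f x) w \<noteq> 0"
    by (simp add: in_keys_iff)
  then obtain a where "a \<in> Poly_Mapping.keys x"
      and "Poly_Mapping.lookup x a * Poly_Mapping.lookup (f a) w \<noteq> 0"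
    unfolding lookup_lin_ext by (meson sum.neutral)
  then have "w \<in> Poly_Mapping.keys (f a)"
    by (auto simp: in_keys_iff)
  then show "w \<in> S" using assms \<open>a \<in> Poly_Mapping.keys x\<close> by auto
qed

lemma keys_basis_subset: "a \<in> S \<Longrightarrow> Poly_Mapping.keys (basis a) \<subseteq> S"
  by (auto simp: basis_def)

lemma lin_ext_basis_id: "lin_ext basis x = x"
  unfolding lin_ext_def by (rule basis_expansion [symmetric])

text \<open>The kernel of the linearisation of a map \<open>f\<close> of bases shrinks as \<open>f\<close> becomes finer: if \<open>g\<close>
  factors through \<open>f\<close>, its linear extension factors through that of \<open>f\<close>. Since \<open>f\<close> and \<open>g\<close>
  are compared on basis elements, this holds over every commutative ring.\<close>

lemma lin_ext_eq_0_if_factors: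
  assumes zero: "lin_ext (\<lambda>a. basis (f a)) x = 0"
    and factors: "\<And>a b. a \<in> Poly_Mapping.keys x \<Longrightarrow> b \<in> Poly_Mapping.keys x \<Longrightarrow> f a = f b \<Longrightarrow> g a = g b"
  shows "lin_ext g x = 0"
proof -
  define h where "h w = g (SOME a. a \<in> Poly_Mapping.keys x \<and> f a = w)" for w
  have "g a = h (f a)" if "a \<in> Poly_Mapping.keys x" for a
  proof -
    have "(SOME b. b \<in> Poly_Mapping.keys x \<and> f b = f a) \<in> Poly_Mapping.keys x \<and>
        f (SOME b. b \<in> Poly_Mapping.keys x \<and> f b = f a) = f a"
      by (rule someI [of _ a]) (use that in simp)
    then show ?thesis
      unfolding h_def using factors that by metis
  qed
  then have "lin_ext g x = lin_ext (\<lambda>a. h (f a)) x"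
    by (rule lin_ext_cong)
  also have "\<dots> = lin_ext h (lin_ext (\<lambda>a. basis (f a)) x)"
    by (simp add: lin_ext_lin_ext)
  finally show ?thesis by (simp add: zero)
qed

section \<open>Standardisation and order patterns\<close>

lemma st_properties:
  assumes "distinct a"
  shows length_st: "length (st a) = length a" and distinct_st: "distinct (st a)"
    and st_less_iff: "p < length a \<Longrightarrow> q < length a \<Longrightarrow> st a ! p < st a ! q \<longleftrightarrow> a ! p < a ! q"
  using theI' [OF st_unique(1) [OF assms]] unfolding st_def [symmetric]
  by (auto simp: perms_iff)

text \<open>On distinct lists, equality of standardisations is equality of order patterns; distinctness
  makes it enough to compare each pair of positions in one direction.\<close>

lemma st_eq_iff:
  assumes "distinct a" "distinct b" "length a = length b"
  shows "st a = st b \<longleftrightarrow> (\<forall>p q. p < q \<longrightarrow> q < length a \<longrightarrow> (a ! p < a ! q \<longleftrightarrow> b ! p < b ! q))"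
proof
  assume eq: "st a = st b"
  show "\<forall>p q. p < q \<longrightarrow> q < length a \<longrightarrow> (a ! p < a ! q \<longleftrightarrow> b ! p < b ! q)"
  proof (intro allI impI)
    fix p q assume "p < q" "q < length a"
    then show "a ! p < a ! q \<longleftrightarrow> b ! p < b ! q"
      using eq st_less_iff [OF assms(1), of p q] st_less_iff [OF assms(2), of p q] assms(3) by simp
  qed
next
  assume asm: "\<forall>p q. p < q \<longrightarrow> q < length a \<longrightarrow> (a ! p < a ! q \<longleftrightarrow> b ! p < b ! q)"
  have all: "a ! p < a ! q \<longleftrightarrow> b ! p < b ! q" if "p < length a" "q < length a" for p q
  proof (cases p q rule: linorder_cases)
    case greater
    then have "a ! p \<noteq> a ! q" "b ! p \<noteq> b ! q" "a ! q < a ! p \<longleftrightarrow> b ! q < b ! p"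
      using assms that asm by (auto simp: nth_eq_iff_index_eq)
    then show ?thesis by linarith
  qed (use asm that in auto)
  have "(\<forall>p<length a. \<forall>q<length a. t ! p < t ! q \<longleftrightarrow> a ! p < a ! q) \<longleftrightarrow>
      (\<forall>p<length a. \<forall>q<length a. t ! p < t ! q \<longleftrightarrow> b ! p < b ! q)" for t :: "nat list"
    using all by simp
  then show "st a = st b"
    by (simp add: st_def flip: assms(3))
qed

lemma st_perm:
  assumes "t \<in> perms n"
  shows "st t = t"
proof -
  from assms have "distinct t" "t \<in> perms (length t)" by (auto simp: perms_iff)
  then show "st t = t"
    unfolding st_def by (intro the1_equality [OF st_unique(1)]) auto
qed

lemma st_take_st: "distinct a \<Longrightarrow> st (take l (st a)) = st (take l a)"
  by (subst st_eq_iff) (auto simp: length_st distinct_st st_less_iff)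

lemma st_drop_st: "distinct a \<Longrightarrow> st (drop l (st a)) = st (drop l a)"
  by (subst st_eq_iff) (auto simp: length_st distinct_st st_less_iff)

section \<open>The iterated coproduct as a sum over compositions\<close>

text \<open>Cuts are described by the lengths of the resulting blocks. Since a composition does not mention
  the list that is cut, one composition can be applied to all permutations in the support of an
  element of \<open>\<A> n\<close>.\<close>

definition compositions :: "nat \<Rightarrow> nat \<Rightarrow> nat list set" where
  "compositions r n = {c. length c = r \<and> sum_list c = n \<and> 0 \<notin> set c}"

fun cut :: "nat list \<Rightarrow> 'a list \<Rightarrow> 'a list list" where
  "cut [] a = []"
| "cut (l # c) a = take l a # cut c (drop l a)"

lemma finite_compositions: "finite (compositions r n)"
proof (rule finite_subset)
  show "compositions r n \<subseteq> {c. set c \<subseteq> {..n} \<and> length c = r}"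
    by (auto simp: compositions_def dest: member_le_sum_list)
  show "finite {c. set c \<subseteq> {..n} \<and> length c = r}"
    by (rule finite_lists_length_eq) simp
qed

lemma compositions_1: "n \<ge> 1 \<Longrightarrow> compositions 1 n = {[n]}"
  by (auto simp: compositions_def length_Suc_conv)

text \<open>A composition with one more part arises in exactly one way by splitting the first part of a
  composition; this mirrors \<open>\<Delta> \<otimes> id\<close>, which acts on the first tensor factor.\<close>

lemma sum_compositions_Suc:
  "(\<Sum>c\<in>compositions (Suc (Suc r)) n. f c) =
    (\<Sum>c\<in>compositions (Suc r) n. \<Sum>i = 1..hd c - 1. f (i # (hd c - i) # tl c))"
proof -
  let ?S = "Sigma (compositions (Suc r) n) (\<lambda>c. {1..hd c - 1})"
  have "(\<Sum>c\<in>compositions (Suc (Suc r)) n. f c) =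
      (\<Sum>(c, i)\<in>?S. f (i # (hd c - i) # tl c))"
    by (rule sum.reindex_bij_witness [where
          i = "\<lambda>(c, i). i # (hd c - i) # tl c" and
          j = "\<lambda>d. ((hd d + hd (tl d)) # tl (tl d), hd d)"])
      (auto simp: compositions_def length_Suc_conv)
  also have "\<dots> = (\<Sum>c\<in>compositions (Suc r) n. \<Sum>i = 1..hd c - 1. f (i # (hd c - i) # tl c))"
    by (subst sum.Sigma) (auto simp: finite_compositions)
  finally show ?thesis .
qed

lemma lengths_cut:
  "sum_list c = length a \<Longrightarrow> map length (cut c a) = c"
  by (induction c arbitrary: a) auto

lemma distinct_cut: "distinct a \<Longrightarrow> w \<in> set (cut c a) \<Longrightarrow> distinct w"
proof (induction c arbitrary: a)
  case (Cons l c)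
  then show ?case using Cons.IH [of "drop l a"] by auto
qed simp

lemma lengths_st_cut:
  assumes "distinct a" "sum_list c = length a"
  shows "map length (map st (cut c a)) = c"
proof -
  have "map length (map st (cut c a)) = map length (cut c a)"
    using assms(1) by (auto simp: length_st dest: distinct_cut)
  then show ?thesis using assms(2) by (simp add: lengths_cut)
qed

lemma tensor_basis_Nil: "tensor x (basis []) = x"
  by (simp add: tensor_def lin_ext_basis_id)

lemma tensor_map_Delta_basis:
  "tensor_map Delta id (basis (s # v)) =
    (\<Sum>i = 1..length s - 1. basis (st (take i s) # st (drop i s) # v))"
  by (simp add: tensor_map_def Delta_def tensor_def lin_ext_sum)

text \<open>One more coproduct cuts the leading block of a composition in two; standardising that block
  beforehand does not change the standardisation of its pieces.\<close>

lemma tensor_map_Delta_cuts: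
  assumes a: "distinct a" and n: "length a = n"
  shows "tensor_map Delta id (\<Sum>c\<in>compositions (Suc r) n. basis (map st (cut c a))) =
    (\<Sum>c\<in>compositions (Suc (Suc r)) n. basis (map st (cut c a)))"
proof -
  have refine: "tensor_map Delta id (basis (map st (cut c a))) =
      (\<Sum>i = 1..hd c - 1. basis (map st (cut (i # (hd c - i) # tl c) a)))"
    if "c \<in> compositions (Suc r) n" for c
  proof -
    from that obtain l d where c: "c = l # d" and "sum_list c = n"
      by (auto simp: compositions_def length_Suc_conv)
    then have l: "l \<le> length a" using n by simp
    have len: "length (st (take l a)) = l"
      using a l by (simp add: length_st)
    have pieces: "basis (st (take i (st (take l a))) # st (drop i (st (take l a))) # map st (cut d (drop l a))) =
        basis (map st (cut (i # (l - i) # d) a))" if "i \<in> {1..l - 1}" for i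
    proof -
      have "i \<le> l" using that by auto
      then show ?thesis
        using a by (simp add: st_take_st st_drop_st min_absorb1 drop_take)
    qed
    show ?thesis
      by (simp only: c cut.simps(2) [of l] list.map tensor_map_Delta_basis len list.sel
          sum.cong [OF refl pieces])
  qed
  have "tensor_map Delta id (\<Sum>c\<in>compositions (Suc r) n. basis (map st (cut c a))) =
      (\<Sum>c\<in>compositions (Suc r) n. tensor_map Delta id (basis (map st (cut c a))))"
    unfolding tensor_map_def by (rule lin_ext_sum)
  also have "\<dots> = (\<Sum>c\<in>compositions (Suc (Suc r)) n. basis (map st (cut c a)))"
    unfolding sum_compositions_Suc by (rule sum.cong [OF refl refine])
  finally show ?thesis .
qed

lemma Delta_iter_basis:
  assumes a: "a \<in> perms n" and n: "n \<ge> 1"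
  shows "Delta_iter (Suc k) (basis a) =
    (\<Sum>c\<in>compositions (Suc (Suc k)) n. basis (map st (cut c a)))"
proof (induction k)
  case 0
  have len: "distinct a" "length a = n" using a by (simp_all add: perms_iff)
  (* A permutation is its own standardisation, so basis [a] is the sum over the one composition
     with a single part, and the refinement step applies from there on. *)
  have "Delta (basis a) = tensor_map Delta id (basis [a])"
    by (simp add: tensor_map_def tensor_basis_Nil)
  also have "basis [a] = (\<Sum>c\<in>compositions (Suc 0) n. basis (map st (cut c a)))"
    using compositions_1 [OF n] len st_perm [OF a] by simp
  also have "tensor_map Delta id \<dots> = (\<Sum>c\<in>compositions (Suc (Suc 0)) n. basis (map st (cut c a)))"
    using len by (rule tensor_map_Delta_cuts)
  finally show ?case by simp
next
  case (Suc k)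
  then show ?case
    using a tensor_map_Delta_cuts [of a n "Suc k"] by (simp add: perms_iff)
qed

lemma module_hom_Delta_iter: "module_hom scale scale (Delta_iter (Suc k))"
proof (induction k)
  case 0
  then show ?case by (simp add: Delta_def module_hom_lin_ext)
next
  case (Suc k)
  show ?case
    unfolding Delta_iter.simps(2) tensor_map_def
    by (rule module_hom_compose [OF Suc module_hom_lin_ext])
qed

text \<open>The words produced by distinct compositions have distinct length vectors, so nothing can
  cancel between them and the iterated coproduct vanishes composition by composition.\<close>

lemma Delta_iter_eq_0_iff:
  assumes x: "x \<in> \<A> n" and n: "n \<ge> 1"
  shows "Delta_iter (Suc k) x = 0 \<longleftrightarrow>
    (\<forall>c\<in>compositions (Suc (Suc k)) n. lin_ext (\<lambda>a. basis (map st (cut c a))) x = 0)"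
proof -
  let ?W = "\<lambda>c. lin_ext (\<lambda>a. basis (map st (cut c a))) x"
  let ?K = "compositions (Suc (Suc k)) n"
  have keys: "a \<in> perms n" if "a \<in> Poly_Mapping.keys x" for a
    using that x by (auto simp: \<A>_def)
  have "Delta_iter (Suc k) x = lin_ext (\<lambda>a. Delta_iter (Suc k) (basis a)) x"
    by (rule lin_ext_hom [OF module_hom_Delta_iter])
  also have "\<dots> = lin_ext (\<lambda>a. \<Sum>c\<in>?K. basis (map st (cut c a))) x"
    by (rule lin_ext_cong) (rule Delta_iter_basis [OF keys n])
  also have "\<dots> = (\<Sum>c\<in>?K. ?W c)"
    by (rule lin_ext_sum_functions)
  finally have sum: "Delta_iter (Suc k) x = (\<Sum>c\<in>?K. ?W c)" .
  have other: "Poly_Mapping.lookup (?W c) w = 0" if "c \<in> ?K" "c \<noteq> map length w" for c w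
  proof -
    have "map st (cut c a) \<noteq> w" if "a \<in> Poly_Mapping.keys x" for a
      using lengths_st_cut [of a c] keys [OF that] \<open>c \<in> ?K\<close> \<open>c \<noteq> map length w\<close>
      by (auto simp: perms_iff compositions_def)
    then show ?thesis
      by (simp add: lookup_lin_ext basis_def lookup_single)
  qed
  show ?thesis
  proof
    assume zero: "Delta_iter (Suc k) x = 0"
    show "\<forall>c\<in>?K. ?W c = 0"
    proof (intro ballI poly_mapping_eqI)
      fix c w assume c: "c \<in> ?K"
      show "Poly_Mapping.lookup (?W c) w = Poly_Mapping.lookup 0 w"
      proof (cases "c = map length w")
        case True
        have "0 = (\<Sum>c\<in>?K. Poly_Mapping.lookup (?W c) w)"
          using arg_cong [OF zero, of "\<lambda>z. Poly_Mapping.lookup z w"] by (simp add: sum lookup_sum)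
        also have "\<dots> = Poly_Mapping.lookup (?W c) w"
          using c other True
          by (subst sum.remove [OF finite_compositions c]) (auto intro!: sum.neutral)
        finally show ?thesis by simp
      qed (use c other in simp)
    qed
  qed (simp add: sum)
qed

section \<open>Cut sets\<close>

text \<open>A composition of \<open>n\<close> is the same as the set of its proper partial sums; the number \<open>j\<close>
  in a cut set marks the gap between the (zero-based) positions \<open>j - 1\<close> and \<open>j\<close>.\<close>

fun cut_set :: "nat list \<Rightarrow> nat set" where
  "cut_set [] = {}"
| "cut_set [l] = {}"
| "cut_set (l # l' # c) = insert l ((+) l ` cut_set (l' # c))"

lemma cut_set_subset:
  "0 \<notin> set c \<Longrightarrow> cut_set c \<subseteq> {1..<sum_list c}"
proof (induction c rule: cut_set.induct)
  case (3 l l' c)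
  then have "cut_set (l' # c) \<subseteq> {1..<sum_list (l' # c)}" by simp
  then have "(+) l ` cut_set (l' # c) \<subseteq> {1..<l + sum_list (l' # c)}" by auto
  then show ?case using 3(2) by auto
qed auto

lemma card_cut_set:
  "0 \<notin> set c \<Longrightarrow> card (cut_set c) = length c - 1"
proof (induction c rule: cut_set.induct)
  case (3 l l' c)
  have "cut_set (l' # c) \<subseteq> {1..<sum_list (l' # c)}"
    using 3(2) by (intro cut_set_subset) simp
  then have "finite (cut_set (l' # c))" "l \<notin> (+) l ` cut_set (l' # c)"
    by (auto dest: finite_subset)
  then show ?case using 3 by (simp add: card_image)
qed auto

text \<open>The first part is the least cut; the remaining cuts, moved back by it, are those of the
  remaining parts.\<close>

lemma composition_of_cut_set:
  assumes "C \<subseteq> {1..<n}" "n \<ge> 1"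
  shows "\<exists>c\<in>compositions (Suc (card C)) n. cut_set c = C"
  using assms
proof (induction "card C" arbitrary: C n)
  case 0
  then have "C = {}" using finite_subset by fastforce
  then show ?case using 0 compositions_1 [of n] by auto
next
  case (Suc r)
  have fin: "finite C" using Suc.prems finite_subset by blast
  have "C \<noteq> {}" using Suc.hyps by auto
  define l where "l = Min C"
  have l: "l \<in> C" "\<And>j. j \<in> C \<Longrightarrow> l \<le> j"
    using fin \<open>C \<noteq> {}\<close> by (simp_all add: l_def)
  define D where "D = (\<lambda>j. j - l) ` (C - {l})"
  have D_shift: "(+) l ` D = C - {l}"
    using l(2) by (force simp: D_def image_image)
  have "inj_on (\<lambda>j. j - l) (C - {l})"
    using l(2) by (intro inj_onI) (metis DiffD1 le_add_diff_inverse)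
  then have cardD: "card D = r"
    using fin l(1) Suc.hyps(2) by (simp add: D_def card_image)
  have D: "D \<subseteq> {1..<n - l}"
  proof
    fix d assume "d \<in> D"
    then have "l + d \<in> C - {l}" using D_shift by blast
    then show "d \<in> {1..<n - l}" using Suc.prems(1) by auto
  qed
  have ln: "1 \<le> l" "l < n" using l(1) Suc.prems(1) by auto
  obtain c where c: "c \<in> compositions (Suc r) (n - l)" "cut_set c = D"
    using Suc.hyps(1) [of D "n - l"] cardD D ln by (auto simp: Suc_le_eq)
  from c(1) obtain l' d where c': "c = l' # d"
    by (auto simp: compositions_def length_Suc_conv)
  have "l # c \<in> compositions (Suc (Suc r)) n"
    using c(1) ln by (auto simp: compositions_def)
  moreover have "cut_set (l # c) = C"
    using c(2) D_shift l(1) by (auto simp: c')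
  ultimately show ?case using Suc.hyps(2) by metis
qed

text \<open>Two lists agree along \<open>C\<close> if they have the same order pattern inside every block: the
  condition on \<open>{p<..q}\<close> says that no cut separates the positions \<open>p\<close> and \<open>q\<close>. Unlike the list of
  standardised blocks, this can be tested position by position.\<close>

definition agree :: "nat set \<Rightarrow> nat list \<Rightarrow> nat list \<Rightarrow> bool" where
  "agree C a b \<longleftrightarrow> (\<forall>p q. p < q \<longrightarrow> q < length a \<longrightarrow> C \<inter> {p<..q} = {} \<longrightarrow>
     (a ! p < a ! q \<longleftrightarrow> b ! p < b ! q))"

lemma agree_refl: "agree C a a"
  by (simp add: agree_def)

text \<open>A pair of positions that is not separated lies on one side of the first cut \<open>l\<close>.\<close>

lemma agree_insert_cut:
  assumes l: "l \<le> length a" and ab: "length a = length b" and l1: "0 < l"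
    and C: "C \<subseteq> {1..}"
  shows "agree (insert l ((+) l ` C)) a b \<longleftrightarrow>
    agree {} (take l a) (take l b) \<and> agree C (drop l a) (drop l b)"
proof (intro iffI conjI)
  assume asm: "agree (insert l ((+) l ` C)) a b"
  show "agree {} (take l a) (take l b)"
    unfolding agree_def
  proof (intro allI impI)
    fix p q assume pq: "p < q" "q < length (take l a)"
    then have "insert l ((+) l ` C) \<inter> {p<..q} = {}" by auto
    then have "a ! p < a ! q \<longleftrightarrow> b ! p < b ! q"
      using asm pq unfolding agree_def by auto
    then show "take l a ! p < take l a ! q \<longleftrightarrow> take l b ! p < take l b ! q"
      using pq by simp
  qed
  show "agree C (drop l a) (drop l b)"
    unfolding agree_def
  proof (intro allI impI)
    fix p q assume pq: "p < q" "q < length (drop l a)" "C \<inter> {p<..q} = {}"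
    then have "insert l ((+) l ` C) \<inter> {l + p<..l + q} = {}" by auto
    moreover have "l + p < l + q" "l + q < length a" using pq by auto
    ultimately have "a ! (l + p) < a ! (l + q) \<longleftrightarrow> b ! (l + p) < b ! (l + q)"
      using asm unfolding agree_def by blast
    then show "drop l a ! p < drop l a ! q \<longleftrightarrow> drop l b ! p < drop l b ! q"
      using pq ab by simp
  qed
next
  assume asm: "agree {} (take l a) (take l b) \<and> agree C (drop l a) (drop l b)"
  show "agree (insert l ((+) l ` C)) a b"
    unfolding agree_def
  proof (intro allI impI)
    fix p q assume pq: "p < q" "q < length a" "insert l ((+) l ` C) \<inter> {p<..q} = {}"
    then have "l \<notin> {p<..q}" by auto
    then consider "q < l" | "l \<le> p" by fastforce
    then show "a ! p < a ! q \<longleftrightarrow> b ! p < b ! q"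
    proof cases
      case 1
      then have "take l a ! p < take l a ! q \<longleftrightarrow> take l b ! p < take l b ! q"
        using asm pq unfolding agree_def by auto
      then show ?thesis using 1 pq by simp
    next
      case 2
      have "C \<inter> {p - l<..q - l} = {}"
      proof (rule ccontr)
        assume "C \<inter> {p - l<..q - l} \<noteq> {}"
        then obtain j where "j \<in> C" "p - l < j" "j \<le> q - l" by auto
        then have "l + j \<in> (+) l ` C \<inter> {p<..q}" using 2 pq(1) by auto
        then show False using pq(3) by blast
      qed
      moreover have "p - l < q - l" "q - l < length (drop l a)" using 2 pq by auto
      ultimately have "drop l a ! (p - l) < drop l a ! (q - l) \<longleftrightarrow>
          drop l b ! (p - l) < drop l b ! (q - l)"
        using asm unfolding agree_def by blast
      then show ?thesis using 2 pq ab l by simp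
    qed
  qed
qed

lemma map_st_cut_eq_iff:
  assumes "distinct a" "distinct b" "length a = sum_list c" "length b = sum_list c" "0 \<notin> set c"
  shows "map st (cut c a) = map st (cut c b) \<longleftrightarrow> agree (cut_set c) a b"
  using assms
proof (induction c arbitrary: a b rule: cut_set.induct)
  case (1 a b)
  then show ?case by (simp add: agree_def)
next
  case (2 l a b)
  then show ?case by (simp add: agree_def st_eq_iff)
next
  case (3 l l' c a b)
  have "st (take l a) = st (take l b) \<longleftrightarrow> agree {} (take l a) (take l b)"
    using 3(2-) by (subst st_eq_iff) (auto simp: agree_def)
  moreover have "map st (cut (l' # c) (drop l a)) = map st (cut (l' # c) (drop l b)) \<longleftrightarrow>
      agree (cut_set (l' # c)) (drop l a) (drop l b)"
    using 3(2-) by (intro 3(1)) auto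
  moreover have "cut_set (l' # c) \<subseteq> {1..}"
    using cut_set_subset [of "l' # c"] 3(6) by auto
  then have "agree (cut_set (l # l' # c)) a b \<longleftrightarrow>
      agree {} (take l a) (take l b) \<and> agree (cut_set (l' # c)) (drop l a) (drop l b)"
    unfolding cut_set.simps using 3(2-) by (intro agree_insert_cut) auto
  ultimately show ?case
    unfolding cut.simps(2) [of l] list.map list.inject by blast
qed

section \<open>Cutting an inserted permutation\<close>

text \<open>The inserted copy of \<open>\<tau>\<close> occupies the zero-based positions \<open>i - 1, \<dots>, i + m - 2\<close> of
  \<open>B i \<sigma> \<tau>\<close>. The map \<open>outer_pos i m\<close> collapses them to the position \<open>i - 1\<close> of \<open>\<sigma>\<close> that they
  replace. Accordingly the gaps up to \<open>i - 1\<close> and from \<open>i + m - 1\<close> on are gaps of \<open>\<sigma>\<close>, and those in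
  between are gaps of \<open>\<tau>\<close>.\<close>

definition outer_pos :: "nat \<Rightarrow> nat \<Rightarrow> nat \<Rightarrow> nat" where
  "outer_pos i m p = (if p < i - 1 then p else if p < i - 1 + m then i - 1 else p - (m - 1))"

definition outer_cuts :: "nat \<Rightarrow> nat \<Rightarrow> nat set \<Rightarrow> nat set" where
  "outer_cuts i m C = {j. j < i \<and> j \<in> C} \<union> {j. i \<le> j \<and> j + (m - 1) \<in> C}"

definition inner_cuts :: "nat \<Rightarrow> nat \<Rightarrow> nat set \<Rightarrow> nat set" where
  "inner_cuts i m C = {j. 1 \<le> j \<and> j < m \<and> j + (i - 1) \<in> C}"

text \<open>Collapsing the block neither moves a position across an outer cut nor merges two positions
  that an outer cut separates.\<close>

lemma outer_pos_less_iff: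
  assumes "m \<ge> 1"
  shows "j < i \<Longrightarrow> outer_pos i m p < j \<longleftrightarrow> p < j"
    and "1 \<le> i \<Longrightarrow> i \<le> j \<Longrightarrow> outer_pos i m p < j \<longleftrightarrow> p < j + (m - 1)"
  using assms unfolding outer_pos_def by (simp_all split: if_split; linarith)+

lemma card_outer_inner_cuts:
  assumes C: "C \<subseteq> {1..<n + m - 1}" and i: "i \<in> {1..n}" and m: "m \<ge> 1"
  shows "outer_cuts i m C \<subseteq> {1..<n}" "inner_cuts i m C \<subseteq> {1..<m}"
    "card (outer_cuts i m C) + card (inner_cuts i m C) = card C"
proof -
  show sub: "outer_cuts i m C \<subseteq> {1..<n}" "inner_cuts i m C \<subseteq> {1..<m}"
    using C i m by (fastforce simp: outer_cuts_def inner_cuts_def)+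
  let ?L = "{j. j < i \<and> j \<in> C}" and ?R = "{j. i \<le> j \<and> j + (m - 1) \<in> C}"
  let ?I = "inner_cuts i m C"
  have fin: "finite ?L" "finite ?R" "finite ?I"
    using sub by (auto simp: outer_cuts_def intro: finite_subset)
  have C_split: "C = ?L \<union> ((\<lambda>j. j + (i - 1)) ` ?I \<union> (\<lambda>j. j + (m - 1)) ` ?R)"
  proof (intro set_eqI iffI)
    fix j assume j: "j \<in> C"
    consider "j < i" | "i \<le> j" "j < i + (m - 1)" | "i + (m - 1) \<le> j" by linarith
    then show "j \<in> ?L \<union> ((\<lambda>j. j + (i - 1)) ` ?I \<union> (\<lambda>j. j + (m - 1)) ` ?R)"
    proof cases
      case 2
      then have "j - (i - 1) \<in> ?I" "j = j - (i - 1) + (i - 1)"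
        using j i m by (auto simp: inner_cuts_def)
      then show ?thesis by blast
    next
      case 3
      then have "j - (m - 1) \<in> ?R" "j = j - (m - 1) + (m - 1)"
        using j by auto
      then show ?thesis by blast
    qed (use j in simp)
  qed (auto simp: inner_cuts_def)
  have "card C = card ?L + card ((\<lambda>j. j + (i - 1)) ` ?I \<union> (\<lambda>j. j + (m - 1)) ` ?R)"
    by (subst C_split, rule card_Un_disjoint)
      (use fin i in \<open>auto simp: inner_cuts_def\<close>)
  also have "card ((\<lambda>j. j + (i - 1)) ` ?I \<union> (\<lambda>j. j + (m - 1)) ` ?R) =
      card ((\<lambda>j. j + (i - 1)) ` ?I) + card ((\<lambda>j. j + (m - 1)) ` ?R)"
    by (rule card_Un_disjoint) (use fin i in \<open>auto simp: inner_cuts_def\<close>)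
  finally have "card C = card ?L + (card ?I + card ?R)"
    by (simp add: card_image)
  moreover have "card (outer_cuts i m C) = card ?L + card ?R"
    unfolding outer_cuts_def by (rule card_Un_disjoint) (use fin in auto)
  ultimately show "card (outer_cuts i m C) + card ?I = card C" by simp
qed

lemma nth_B:
  assumes \<sigma>: "\<sigma> \<in> perms n" and \<tau>: "\<tau> \<in> perms m" and i: "i \<in> {1..n}" and m: "m \<ge> 1"
    and p: "p < n + m - 1"
  shows "B i \<sigma> \<tau> ! p =
    (if outer_pos i m p = i - 1 then \<tau> ! (p - (i - 1)) + \<sigma> ! (i - 1) - 1
     else if \<sigma> ! outer_pos i m p < \<sigma> ! (i - 1) then \<sigma> ! outer_pos i m p
     else \<sigma> ! outer_pos i m p + m - 1)"
proof -
  have len: "length \<sigma> = n" "length \<tau> = m" using \<sigma> \<tau> by (simp_all add: perms_iff)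
  have B: "B i \<sigma> \<tau> = map (\<lambda>v. if v < \<sigma> ! (i - 1) then v else v + m - 1) (take (i - 1) \<sigma>) @
      map (\<lambda>v. v + \<sigma> ! (i - 1) - 1) \<tau> @
      map (\<lambda>v. if v < \<sigma> ! (i - 1) then v else v + m - 1) (drop i \<sigma>)"
    by (simp only: B_def Let_def len)
  have lens: "min n (i - 1) = i - 1" using i by auto
  consider "p < i - 1" | "i - 1 \<le> p" "p < i - 1 + m" | "i - 1 + m \<le> p" by linarith
  then show ?thesis
  proof cases
    case 1
    then have "p < n" using i by auto
    then show ?thesis
      using 1 by (simp add: B nth_append len lens [simplified] outer_pos_def)
  next
    case 2
    then have "p - (i - 1) < m" by linarith
    then show ?thesis
      using 2 by (simp add: B nth_append lens len outer_pos_def del: One_nat_def)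
  next
    case 3
    then have tail: "p - (i - 1) - m < n - i" "i + (p - (i - 1) - m) = p - (m - 1)"
      and neg: "p - (m - 1) \<noteq> i - 1" "\<not> p < i - 1" "\<not> p - (i - 1) < m" "\<not> p < i - 1 + m"
      using i m p unfolding atLeastAtMost_iff by linarith+
    have drop: "p - (i - 1) - m < length (drop i \<sigma>)"
        "drop i \<sigma> ! (p - (i - 1) - m) = \<sigma> ! (p - (m - 1))"
      using tail i len by simp_all
    show ?thesis
      by (simp only: B nth_append length_map length_take len lens neg drop nth_map
          outer_pos_def if_False)
  qed
qed

text \<open>Here \<open>s\<close> is the value that is replaced by the interval \<open>{s..<s + m}\<close>: values of the block are
  \<open>u + s - 1\<close> with \<open>1 \<le> u \<le> m\<close>, and the values above \<open>s\<close> move up by \<open>m - 1\<close>.\<close>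

lemma inflate_less:
  fixes s u v w m :: nat
  shows "1 \<le> u \<Longrightarrow> 1 \<le> v \<Longrightarrow> u + s - 1 < v + s - 1 \<longleftrightarrow> u < v"
    and "1 \<le> s \<Longrightarrow> 1 \<le> u \<and> u \<le> m \<Longrightarrow> v \<noteq> s \<Longrightarrow>
      u + s - 1 < (if v < s then v else v + m - 1) \<longleftrightarrow> s < v"
    and "1 \<le> s \<Longrightarrow> 1 \<le> u \<and> u \<le> m \<Longrightarrow> v \<noteq> s \<Longrightarrow>
      (if v < s then v else v + m - 1) < u + s - 1 \<longleftrightarrow> v < s"
    and "1 \<le> m \<Longrightarrow> v \<noteq> s \<Longrightarrow> w \<noteq> s \<Longrightarrow>
      (if v < s then v else v + m - 1) < (if w < s then w else w + m - 1) \<longleftrightarrow> v < w"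
  by auto

text \<open>Substituting a block for a point keeps the order: entries at different outer positions compare
  as in \<open>\<sigma>\<close>, entries of the block as in \<open>\<tau>\<close>.\<close>

lemma B_less_iff:
  assumes \<sigma>: "\<sigma> \<in> perms n" and \<tau>: "\<tau> \<in> perms m" and i: "i \<in> {1..n}" and m: "m \<ge> 1"
    and pq: "p < q" "q < n + m - 1"
  shows "B i \<sigma> \<tau> ! p < B i \<sigma> \<tau> ! q \<longleftrightarrow>
    (if outer_pos i m p = outer_pos i m q then \<tau> ! (p - (i - 1)) < \<tau> ! (q - (i - 1))
     else \<sigma> ! outer_pos i m p < \<sigma> ! outer_pos i m q)"
proof -
  let ?o = "outer_pos i m"
  have len: "length \<sigma> = n" "length \<tau> = m" "set \<sigma> = {1..n}" "set \<tau> = {1..m}" "distinct \<sigma>"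
    using \<sigma> \<tau> by (auto simp: perms_iff)
  have o: "?o r < n" if "r < n + m - 1" for r
    using that i m by (auto simp: outer_pos_def)
  have ne: "\<sigma> ! r \<noteq> \<sigma> ! (i - 1)" if "r < n" "r \<noteq> i - 1" for r
  proof -
    have "i - 1 < n" using i by auto
    then show ?thesis using that len by (simp add: nth_eq_iff_index_eq)
  qed
  have pos: "1 \<le> \<sigma> ! r" if "r < n" for r
    using nth_mem [of r \<sigma>] that len by auto
  have inner: "1 \<le> \<tau> ! (r - (i - 1)) \<and> \<tau> ! (r - (i - 1)) \<le> m" if "?o r = i - 1" "r < n + m - 1" for r
  proof -
    have "r - (i - 1) < m" using that i m by (auto simp: outer_pos_def split: if_splits)
    then show ?thesis using nth_mem [of "r - (i - 1)" \<tau>] len by auto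
  qed
  have same: "?o p = i - 1" if "?o p = ?o q"
    using that pq i m by (auto simp: outer_pos_def split: if_splits)
  have p': "p < n + m - 1" using pq by simp
  have s: "1 \<le> \<sigma> ! (i - 1)" using pos i by auto
  note nth = nth_B [OF \<sigma> \<tau> i m p'] nth_B [OF \<sigma> \<tau> i m pq(2)]
  show ?thesis
  proof (cases "?o p = i - 1"; cases "?o q = i - 1")
    assume *: "?o p = i - 1" "?o q = i - 1"
    then show ?thesis
      unfolding nth using s inner [OF *(1) p'] inner [OF *(2) pq(2)] by (simp only: if_True inflate_less refl)
  next
    assume *: "?o p = i - 1" "?o q \<noteq> i - 1"
    then show ?thesis
      unfolding nth using *(2) [THEN not_sym]
      by (simp only: if_True if_False refl
          inflate_less(2) [OF s inner [OF *(1) p'] ne [OF o [OF pq(2)] *(2)]])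
  next
    assume *: "?o p \<noteq> i - 1" "?o q = i - 1"
    then show ?thesis
      unfolding nth using *(1)
      by (simp only: if_True if_False refl
          inflate_less(3) [OF s inner [OF *(2) pq(2)] ne [OF o [OF p'] *(1)]])
  next
    assume *: "?o p \<noteq> i - 1" "?o q \<noteq> i - 1"
    then have "?o p \<noteq> ?o q" using same by blast
    then show ?thesis
      unfolding nth using *
      by (simp only: if_True if_False refl
          inflate_less(4) [OF m ne [OF o [OF p'] *(1)] ne [OF o [OF pq(2)] *(2)]])
  qed
qed

text \<open>A pair of positions that no cut separates is compared through \<open>\<tau>\<close> if both positions lie in the
  inserted block, and then no inner cut separates them; otherwise it is compared through \<open>\<sigma>\<close> at the
  collapsed positions, and then no outer cut separates those.\<close>

lemma agree_B:
  assumes \<sigma>: "\<sigma> \<in> perms n" "\<sigma>' \<in> perms n" and \<tau>: "\<tau> \<in> perms m" "\<tau>' \<in> perms m"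
    and i: "i \<in> {1..n}" and m: "m \<ge> 1"
    and outer: "agree (outer_cuts i m C) \<sigma> \<sigma>'" and inner: "agree (inner_cuts i m C) \<tau> \<tau>'"
  shows "agree C (B i \<sigma> \<tau>) (B i \<sigma>' \<tau>')"
  unfolding agree_def
proof (intro allI impI)
  fix p q assume pq: "p < q" "q < length (B i \<sigma> \<tau>)" and C: "C \<inter> {p<..q} = {}"
  let ?o = "outer_pos i m"
  have q: "q < n + m - 1"
    using pq B_in_perms [OF \<sigma>(1) \<tau>(1) i m] by (simp add: perms_iff)
  have len: "length \<sigma> = n" "length \<tau> = m" using \<sigma> \<tau> by (simp_all add: perms_iff)
  have noC: "j \<notin> C" if "p < j" "j \<le> q" for j using C that by auto
  show "B i \<sigma> \<tau> ! p < B i \<sigma> \<tau> ! q \<longleftrightarrow> B i \<sigma>' \<tau>' ! p < B i \<sigma>' \<tau>' ! q"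
  proof (cases "?o p = ?o q")
    case True
    then have block: "i - 1 \<le> p" "q < i - 1 + m"
      using pq(1) i m by (auto simp: outer_pos_def split: if_splits)
    have "inner_cuts i m C \<inter> {p - (i - 1)<..q - (i - 1)} = {}"
    proof (rule ccontr)
      assume "inner_cuts i m C \<inter> {p - (i - 1)<..q - (i - 1)} \<noteq> {}"
      then obtain j where "j + (i - 1) \<in> C" "p - (i - 1) < j" "j \<le> q - (i - 1)"
        by (auto simp: inner_cuts_def)
      moreover from this have "p < j + (i - 1)" "j + (i - 1) \<le> q" using block pq(1) by linarith+
      ultimately show False using noC by blast
    qed
    moreover have "p - (i - 1) < q - (i - 1)" "q - (i - 1) < length \<tau>"
      using block pq(1) len by auto
    ultimately have "\<tau> ! (p - (i - 1)) < \<tau> ! (q - (i - 1)) \<longleftrightarrow>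
        \<tau>' ! (p - (i - 1)) < \<tau>' ! (q - (i - 1))"
      using inner unfolding agree_def by blast
    then show ?thesis
      using True by (simp add: B_less_iff [OF \<sigma>(1) \<tau>(1) i m pq(1) q]
          B_less_iff [OF \<sigma>(2) \<tau>(2) i m pq(1) q])
  next
    case False
    have "?o p \<le> ?o q"
      unfolding outer_pos_def using pq(1) m by (simp split: if_split; linarith)
    moreover have "?o q < n"
      unfolding outer_pos_def using q i m by (simp split: if_split; linarith)
    ultimately have less: "?o p < ?o q" "?o q < n"
      using False by simp_all
    have "outer_cuts i m C \<inter> {?o p<..?o q} = {}"
    proof (rule ccontr)
      assume "outer_cuts i m C \<inter> {?o p<..?o q} \<noteq> {}"
      then obtain j where "j \<in> outer_cuts i m C" "j \<in> {?o p<..?o q}"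
        by blast
      then have j: "?o p < j" "j \<le> ?o q" "j < i \<and> j \<in> C \<or> i \<le> j \<and> j + (m - 1) \<in> C"
        by (auto simp: outer_cuts_def)
      from j(3) show False
      proof
        assume *: "j < i \<and> j \<in> C"
        then have "p < j" "j \<le> q"
          using j(1,2) outer_pos_less_iff(1) [OF m, of j i p] outer_pos_less_iff(1) [OF m, of j i q]
          by linarith+
        then show False using noC * by blast
      next
        assume *: "i \<le> j \<and> j + (m - 1) \<in> C"
        then have "p < j + (m - 1)" "j + (m - 1) \<le> q"
          using j(1,2) i outer_pos_less_iff(2) [OF m, of i j p] outer_pos_less_iff(2) [OF m, of i j q]
          by simp_all
        then show False using noC * by blast
      qed
    qed
    then have "\<sigma> ! ?o p < \<sigma> ! ?o q \<longleftrightarrow> \<sigma>' ! ?o p < \<sigma>' ! ?o q"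
      using outer less len unfolding agree_def by blast
    then show ?thesis
      using False by (simp add: B_less_iff [OF \<sigma>(1) \<tau>(1) i m pq(1) q]
          B_less_iff [OF \<sigma>(2) \<tau>(2) i m pq(1) q])
  qed
qed

section \<open>The filtration\<close>

lemma \<A>_subset_H: "n \<ge> 1 \<Longrightarrow> \<A> n \<subseteq> H"
  by (auto simp: \<A>_def H_def)

lemma mem_Afilt_iff:
  "n \<ge> 1 \<Longrightarrow> x \<in> Afilt k n \<longleftrightarrow> x \<in> \<A> n \<and> Delta_iter (Suc k) x = 0"
  using \<A>_subset_H by (auto simp: Afilt_def Hker_def)

lemma Afilt_Suc:
  assumes "n \<ge> 1" shows "Afilt k n \<subseteq> Afilt (Suc k) n"
  using assms by (auto simp: mem_Afilt_iff tensor_map_def)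

lemma Afilt_mono: "n \<ge> 1 \<Longrightarrow> k \<le> l \<Longrightarrow> Afilt k n \<subseteq> Afilt l n"
  by (rule lift_Suc_mono_le [of "\<lambda>k. Afilt k n"]) (simp_all add: Afilt_Suc)

lemma subspace_Afilt:
  assumes "n \<ge> 1"
  shows "free_module.subspace (Afilt k n :: (nat list \<Rightarrow>\<^sub>0 'a::comm_ring_1) set)"
proof -
  interpret D: module_hom scale scale "Delta_iter (Suc k) :: (nat list \<Rightarrow>\<^sub>0 'a) \<Rightarrow> _"
    by (rule module_hom_Delta_iter)
  show ?thesis
  proof (rule free_module.subspaceI)
    show "(0 :: nat list \<Rightarrow>\<^sub>0 'a) \<in> Afilt k n"
      unfolding mem_Afilt_iff [OF assms] using D.zero by (auto simp: \<A>_def)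
    fix x y :: "nat list \<Rightarrow>\<^sub>0 'a" and c
    assume x: "x \<in> Afilt k n"
    then show "scale c x \<in> Afilt k n"
      unfolding mem_Afilt_iff [OF assms] D.scale by (fastforce simp: \<A>_def in_keys_iff)
    assume "y \<in> Afilt k n"
    with x show "x + y \<in> Afilt k n"
      unfolding mem_Afilt_iff [OF assms] D.add using keys_add [of x y] by (auto simp: \<A>_def)
  qed
qed

lemma subspace_sequence_Afilt: "subspace_sequence (Afilt k)"
  by (auto simp: subspace_sequence_def subspace_Afilt mem_Afilt_iff)

text \<open>Membership in \<open>Afilt k n\<close> is used in this form: the element is killed by every linear map that
  sees permutations only through their patterns along a set of more than \<open>k\<close> cuts. The excess over
  \<open>k + 1\<close> cuts is absorbed by the monotonicity of the filtration.\<close>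

lemma Afilt_cut:
  assumes x: "x \<in> Afilt k n" and n: "n \<ge> 1" and C: "C \<subseteq> {1..<n}" "k < card C"
    and g: "\<And>\<sigma> \<sigma>'. \<sigma> \<in> perms n \<Longrightarrow> \<sigma>' \<in> perms n \<Longrightarrow> agree C \<sigma> \<sigma>' \<Longrightarrow> g \<sigma> = g \<sigma>'"
  shows "lin_ext g x = 0"
proof -
  obtain c where c: "c \<in> compositions (Suc (card C)) n" "cut_set c = C"
    using composition_of_cut_set C(1) n by blast
  obtain l where l: "card C = Suc l" "k \<le> l" using C(2) by (cases "card C") auto
  then have "x \<in> Afilt l n" using x Afilt_mono n by blast
  then have xA: "x \<in> \<A> n" and "Delta_iter (Suc l) x = 0"
    using mem_Afilt_iff [OF n] by blast+
  then have "lin_ext (\<lambda>a. basis (map st (cut c a))) x = 0"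
    using c(1) Delta_iter_eq_0_iff [OF xA n] l by auto
  then show ?thesis
  proof (elim lin_ext_eq_0_if_factors)
    fix a b assume "a \<in> Poly_Mapping.keys x" "b \<in> Poly_Mapping.keys x"
    then have ab: "a \<in> perms n" "b \<in> perms n" using xA by (auto simp: \<A>_def)
    assume "map st (cut c a) = map st (cut c b)"
    then have "agree C a b"
      using ab c by (subst (asm) map_st_cut_eq_iff) (auto simp: perms_iff compositions_def)
    then show "g a = g b" using ab g by blast
  qed
qed

lemma circ_in_\<A>:
  assumes "x \<in> \<A> n" "y \<in> \<A> m" "i \<in> {1..n}" "m \<ge> 1"
  shows "circ i x y \<in> \<A> (n + m - 1)"
  unfolding \<A>_def circ_def mem_Collect_eq
proof (intro keys_lin_ext_subset)
  fix \<sigma> \<tau> assume "\<sigma> \<in> Poly_Mapping.keys x" "\<tau> \<in> Poly_Mapping.keys y"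
  then have "B i \<sigma> \<tau> \<in> perms (n + m - 1)"
    using assms by (intro B_in_perms) (auto simp: \<A>_def)
  then show "Poly_Mapping.keys (basis (B i \<sigma> \<tau>)) \<subseteq> perms (n + m - 1)"
    by (rule keys_basis_subset)
qed

text \<open>Of \<open>k + h + 1\<close> cuts, more than \<open>k\<close> are outer or more than \<open>h\<close> are inner. In the first case
  \<open>x\<close> is killed by \<open>\<sigma> \<mapsto> \<Sum>\<^sub>\<tau> y\<^sub>\<tau> g(\<sigma>, \<tau>)\<close>, in the second \<open>y\<close> is killed by \<open>\<tau> \<mapsto> g(\<sigma>, \<tau>)\<close> for every
  single \<open>\<sigma>\<close>, where \<open>g(\<sigma>, \<tau>)\<close> is the word of standardised blocks of \<open>B i \<sigma> \<tau>\<close>.\<close>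

lemma circ_in_Afilt:
  assumes n: "n \<ge> 1" and m: "m \<ge> 1" and i: "i \<in> {1..n}"
    and x: "x \<in> Afilt k n" and y: "y \<in> Afilt h m"
  shows "circ i x y \<in> Afilt (k + h) (n + m - 1)"
proof -
  have xA: "x \<in> \<A> n" and yA: "y \<in> \<A> m"
    using x y n m by (simp_all add: mem_Afilt_iff)
  have nm: "n + m - 1 \<ge> 1" using n m by simp
  have xyA: "circ i x y \<in> \<A> (n + m - 1)"
    using xA yA i m by (rule circ_in_\<A>)
  have "lin_ext (\<lambda>a. basis (map st (cut c a))) (circ i x y) = 0"
    if c: "c \<in> compositions (Suc (Suc (k + h))) (n + m - 1)" for c
  proof -
    define C where "C = cut_set c"
    define g where "g \<sigma> \<tau> = map st (cut c (B i \<sigma> \<tau>))" for \<sigma> \<tau>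
    have c': "0 \<notin> set c" "sum_list c = n + m - 1" "length c = Suc (Suc (k + h))"
      using c by (auto simp: compositions_def)
    have C: "C \<subseteq> {1..<n + m - 1}" "card C = Suc (k + h)"
      using cut_set_subset card_cut_set c' by (simp_all add: C_def) fastforce
    let ?O = "outer_cuts i m C" and ?I = "inner_cuts i m C"
    note cuts = card_outer_inner_cuts [OF C(1) i m]
    have g_eq: "g \<sigma> \<tau> = g \<sigma>' \<tau>'"
      if "\<sigma> \<in> perms n" "\<sigma>' \<in> perms n" "\<tau> \<in> perms m" "\<tau>' \<in> perms m"
        "agree ?O \<sigma> \<sigma>'" "agree ?I \<tau> \<tau>'" for \<sigma> \<sigma>' \<tau> \<tau>'
    proof -
      have "agree C (B i \<sigma> \<tau>) (B i \<sigma>' \<tau>')"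
        using that i m by (intro agree_B)
      moreover have "B i \<sigma> \<tau> \<in> perms (n + m - 1)" "B i \<sigma>' \<tau>' \<in> perms (n + m - 1)"
        using that i m by (simp_all only: B_in_perms)
      ultimately show ?thesis
        unfolding g_def C_def using c' by (subst map_st_cut_eq_iff) (auto simp: perms_iff)
    qed
    have keys: "\<sigma> \<in> perms n" if "\<sigma> \<in> Poly_Mapping.keys x" for \<sigma>
      using that xA by (auto simp: \<A>_def)
    have keys': "\<tau> \<in> perms m" if "\<tau> \<in> Poly_Mapping.keys y" for \<tau>
      using that yA by (auto simp: \<A>_def)
    have "lin_ext (\<lambda>\<sigma>. lin_ext (\<lambda>\<tau>. basis (g \<sigma> \<tau>)) y) x = 0"
    proof (cases "k < card ?O")
      case True
      show ?thesis
      proof (rule Afilt_cut [OF x n cuts(1) True])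
        fix \<sigma> \<sigma>' assume "\<sigma> \<in> perms n" "\<sigma>' \<in> perms n" "agree ?O \<sigma> \<sigma>'"
        then show "lin_ext (\<lambda>\<tau>. basis (g \<sigma> \<tau>)) y = lin_ext (\<lambda>\<tau>. basis (g \<sigma>' \<tau>)) y"
          using g_eq keys' agree_refl by (intro lin_ext_cong) metis
      qed
    next
      case False
      then have card: "h < card ?I" using cuts(3) C(2) by simp
      have "lin_ext (\<lambda>\<tau>. basis (g \<sigma> \<tau>)) y = 0" if "\<sigma> \<in> Poly_Mapping.keys x" for \<sigma>
        using g_eq keys [OF that] agree_refl
        by (intro Afilt_cut [OF y m cuts(2) card]) metis
      then show ?thesis by (simp add: lin_ext_def [of _ x])
    qed
    then show ?thesis
      by (simp add: circ_def lin_ext_lin_ext g_def)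
  qed
  then show ?thesis
    using xyA nm by (simp add: mem_Afilt_iff Delta_iter_eq_0_iff del: Delta_iter.simps)
qed

lemma operad_unit_primitive: "operad_unit \<in> Afilt 0 1"
proof -
  have "[1] \<in> perms 1" by (simp add: perms_iff)
  then have "operad_unit \<in> \<A> 1"
    unfolding \<A>_def operad_unit_def mem_Collect_eq by (rule keys_basis_subset)
  moreover have "Delta operad_unit = 0"
    by (simp add: operad_unit_def Delta_def)
  ultimately show ?thesis by (simp add: mem_Afilt_iff)
qed

theorem theorem2p1:
  shows "ns_operad_filtration (Afilt :: nat \<Rightarrow> nat \<Rightarrow> (nat list \<Rightarrow>\<^sub>0 'k::comm_ring_1) set) \<and>
    ns_suboperad (Afilt 0 :: nat \<Rightarrow> (nat list \<Rightarrow>\<^sub>0 'k) set)"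
proof
  show "ns_operad_filtration (Afilt :: nat \<Rightarrow> nat \<Rightarrow> (nat list \<Rightarrow>\<^sub>0 'k) set)"
    unfolding ns_operad_filtration_def
    by (intro conjI allI impI ballI subspace_sequence_Afilt Afilt_Suc circ_in_Afilt)
  have "circ i x y \<in> Afilt 0 (n + m - 1)"
    if "n \<ge> 1" "m \<ge> 1" "i \<in> {1..n}" "x \<in> Afilt 0 n" "y \<in> Afilt 0 m"
    for n m i and x y :: "nat list \<Rightarrow>\<^sub>0 'k"
    using circ_in_Afilt [OF that] by simp
  then show "ns_suboperad (Afilt 0 :: nat \<Rightarrow> (nat list \<Rightarrow>\<^sub>0 'k) set)"
    unfolding ns_suboperad_def
    using subspace_sequence_Afilt operad_unit_primitive by blast
qed

end
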